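(* (1) Let $(G_k,S_k)_{k\in\mathbb{N}}$ be a sequence of marked groups in $\mathcal{G}_n$ which accumulates on $(G,S)\in\mathcal{G}_n$ (i.e. some subsequence converges to $(G,S)$). Then there exists a non-principal ultrafilter $\omega$ on $\mathbb{N}$ such that $G$ embeds in the ultraproduct $\prod_{k\in\mathbb{N}}G_k/\!\sim_\omega$. (2) If the sequence $(G_k,S_k)$ converges to $(G,S)$ in $\mathcal{G}_n$, then $G$ embeds in the ultraproduct $\prod_{k\in\mathbb{N}}G_k/\!\sim_\omega$ for every non-principal ultrafilter $\omega$ on $\mathbb{N}$. (3) Let $(G_k)_{k\in\mathbb{N}}$ be a sequence of groups, let $\omega$ be a non-principal ultrafilter on $\mathbb{N}$, and let $G$ be a finitely generated subgroup of $\prod_{k\in\mathbb{N}}G_k/\!\sim_\omega$, marked by a finite generating family $S$. Then there exist a subsequence $(i_k)_{k\in\mathbb{N}}$ and marked groups $(H_{i_k},S_{i_k})$, with $H_{i_k}$ a subgroup of $G_{i_k}$, such that $(H_{i_k},S_{i_k})$ converges to $(G,S)$ as $k\to\infty$.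
   Context: A marked group $(G,S)$ is a group $G$ with an ordered finite generating family $S=(s_1,\dots,s_n)$ (repetitions allowed); two marked groups are identified if $s_i\mapsto s_i'$ extends to a group isomorphism. $\mathcal{G}_n$ is the set of groups marked by $n$ elements, identified with the set of normal subgroups of the free group $F_n=\langle e_1,\dots,e_n\rangle$ (kernel of $e_i\mapsto s_i$), with the topology induced by the product topology on $2^{F_n}$. An ultrafilter on $\mathbb{N}$ is viewed as a finitely additive measure $\omega$ defined on all subsets of $\mathbb{N}$ with values in $\{0,1\}$ and $\omega(\mathbb{N})=1$; it is non-principal if finite sets have measure $0$. The relation $\sim_\omega$ on $\prod_k G_k$ is equality $\omega$-almost everywhere, and $\prod_k G_k/\!\sim_\omega$ is the ultraproduct. *)

theory Defs
  imports "HOL-Analysis.Analysis" "HOL-Algebra.Algebra"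
begin

text \<open>The letter \<open>(i, True)\<close> stands for the free generator with (0-based) index \<open>i\<close> and
  \<open>(i, False)\<close> for its inverse.  The elements of the free group are the reduced words; the
  product of two reduced words is the reduced form of their concatenation.\<close>

type_synonym letter = "nat \<times> bool"

definition letter_inv :: "letter \<Rightarrow> letter" where
  "letter_inv a = (fst a, \<not> snd a)"

definition reduced_words :: "nat \<Rightarrow> letter list set" where
  "reduced_words n =
     {w. fst ` set w \<subseteq> {..<n} \<and> successively (\<lambda>a b. b \<noteq> letter_inv a) w}"

fun cons_reduce :: "letter \<Rightarrow> letter list \<Rightarrow> letter list" where
  "cons_reduce a [] = [a]"
| "cons_reduce a (b # w) = (if b = letter_inv a then w else a # b # w)"

definition free_group :: "nat \<Rightarrow> letter list monoid" where
  "free_group n =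
     \<lparr>carrier = reduced_words n, monoid.mult = (\<lambda>u v. foldr cons_reduce u v), one = []\<rparr>"

text \<open>The homomorphism \<open>free_group (length S) \<rightarrow> G\<close> that sends the generator with index \<open>i\<close>
  to \<open>S ! i\<close>.\<close>

definition word_eval :: "('a, 'm) monoid_scheme \<Rightarrow> 'a list \<Rightarrow> letter list \<Rightarrow> 'a" where
  "word_eval G S w =
     foldr (\<lambda>(i, b) x. (if b then S ! i else inv\<^bsub>G\<^esub> (S ! i)) \<otimes>\<^bsub>G\<^esub> x) w \<one>\<^bsub>G\<^esub>"

lemma letter_inv_letter_inv [simp]: "letter_inv (letter_inv a) = a"
  by (simp add: letter_inv_def)

lemma fst_letter_inv [simp]: "fst (letter_inv a) = fst a"
  by (simp add: letter_inv_def)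

lemma cons_reduce_reduced:
  assumes "fst a < n" "w \<in> reduced_words n"
  shows "cons_reduce a w \<in> reduced_words n"
  using assms by (cases w) (auto simp: reduced_words_def successively_Cons)

lemma cons_reduce_cancel:
  assumes "w \<in> reduced_words n"
  shows "cons_reduce a (cons_reduce (letter_inv a) w) = w"
proof (cases w)
  case (Cons b v)
  show ?thesis
  proof (cases "b = a")
    case True
    with assms Cons show ?thesis
      by (cases v) (auto simp: reduced_words_def)
  qed (simp add: Cons)
qed simp

lemma Cons_reduced_words:
  "a # u \<in> reduced_words n \<Longrightarrow> fst a < n \<and> u \<in> reduced_words n"
  by (cases u) (simp_all add: reduced_words_def)

lemma foldr_cons_reduce_reduced:
  "u \<in> reduced_words n \<Longrightarrow> v \<in> reduced_words n \<Longrightarrow> foldr cons_reduce u v \<in> reduced_words n"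
proof (induction u)
  case (Cons a u)
  then have "fst a < n" "u \<in> reduced_words n"
    using Cons_reduced_words by blast+
  with Cons show ?case by (simp add: cons_reduce_reduced)
qed simp

lemma foldr_cons_reduce_cons_reduce:
  assumes "v \<in> reduced_words n" "w \<in> reduced_words n"
  shows "foldr cons_reduce (cons_reduce a v) w = cons_reduce a (foldr cons_reduce v w)"
proof (cases v)
  case (Cons b u)
  have "foldr cons_reduce u w \<in> reduced_words n"
    using assms Cons Cons_reduced_words foldr_cons_reduce_reduced by blast
  from cons_reduce_cancel[OF this, of a] show ?thesis
    using Cons by auto
qed simp

lemma foldr_cons_reduce_assoc:
  assumes "u \<in> reduced_words n" "v \<in> reduced_words n" "w \<in> reduced_words n"
  shows "foldr cons_reduce (foldr cons_reduce u v) w = foldr cons_reduce u (foldr cons_reduce v w)"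
  using assms
proof (induction u)
  case (Cons a u)
  then have "u \<in> reduced_words n" by (blast dest: Cons_reduced_words)
  with Cons show ?case
    by (simp add: foldr_cons_reduce_cons_reduce[where n = n] foldr_cons_reduce_reduced)
qed simp

lemma foldr_cons_reduce_Nil: "u \<in> reduced_words n \<Longrightarrow> foldr cons_reduce u [] = u"
proof (induction u)
  case (Cons a u)
  then have "foldr cons_reduce u [] = u" by (blast dest: Cons_reduced_words)
  with Cons.prems show ?case
    by (cases u) (auto simp: reduced_words_def)
qed simp

lemma rev_letter_inv_reduced:
  assumes "u \<in> reduced_words n"
  shows "rev (map letter_inv u) \<in> reduced_words n"
proof -
  have "successively (\<lambda>a b. letter_inv a \<noteq> b) u"
    by (rule successively_mono[where P = "\<lambda>a b. b \<noteq> letter_inv a"])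
       (use assms in \<open>auto simp: reduced_words_def\<close>)
  then have "successively (\<lambda>a b. b \<noteq> letter_inv a) (rev (map letter_inv u))"
    by (auto simp: successively_map successively_rev elim!: successively_mono)
  with assms show ?thesis
    by (auto simp: reduced_words_def image_subset_iff)
qed

lemma foldr_cons_reduce_inverse:
  "u \<in> reduced_words n \<Longrightarrow> w \<in> reduced_words n \<Longrightarrow>
   foldr cons_reduce (rev (map letter_inv u)) (foldr cons_reduce u w) = w"
proof (induction u)
  case (Cons a u)
  then have u: "u \<in> reduced_words n" by (blast dest: Cons_reduced_words)
  have "cons_reduce (letter_inv a) (cons_reduce a (foldr cons_reduce u w)) = foldr cons_reduce u w"
    using cons_reduce_cancel[of "foldr cons_reduce u w" n "letter_inv a"]
          foldr_cons_reduce_reduced[OF u Cons.prems(2)] by simp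
  with Cons u show ?case by simp
qed simp

lemma Nil_reduced_words: "[] \<in> reduced_words n"
  by (simp add: reduced_words_def)

lemma group_free_group: "group (free_group n)"
proof (rule groupI)
  fix u assume "u \<in> carrier (free_group n)"
  then have u: "u \<in> reduced_words n" by (simp add: free_group_def)
  then show "\<exists>y\<in>carrier (free_group n). y \<otimes>\<^bsub>free_group n\<^esub> u = \<one>\<^bsub>free_group n\<^esub>"
    using rev_letter_inv_reduced[OF u] foldr_cons_reduce_inverse[OF u Nil_reduced_words]
      foldr_cons_reduce_Nil[OF u]
    by (auto simp: free_group_def)
qed (auto simp: free_group_def foldr_cons_reduce_reduced foldr_cons_reduce_assoc
      Nil_reduced_words)

context group
begin

lemma letter_eval_closed:
  assumes "set S \<subseteq> carrier G" "fst a < length S"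
  shows "S ! fst a \<in> carrier G"
  using assms nth_mem by blast

lemma word_eval_closed:
  assumes "set S \<subseteq> carrier G" "w \<in> reduced_words (length S)"
  shows "word_eval G S w \<in> carrier G"
  using assms(2)
  by (induction w)
     (use letter_eval_closed[OF assms(1)] in
       \<open>auto simp: word_eval_def split: prod.splits dest!: Cons_reduced_words\<close>)

lemma word_eval_cons_reduce:
  assumes "set S \<subseteq> carrier G" "w \<in> reduced_words (length S)" "fst a < length S"
  shows "word_eval G S (cons_reduce a w) = word_eval G S (a # w)"
proof (cases w)
  case (Cons b v)
  then have "word_eval G S v \<in> carrier G"
    using assms Cons_reduced_words word_eval_closed by blast
  moreover have "S ! fst a \<in> carrier G"
    using assms letter_eval_closed by blast
  ultimately show ?thesis
    using Cons by (auto simp: word_eval_def letter_inv_def split_beta m_assoc[symmetric])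
qed simp

lemma word_eval_hom:
  assumes "set S \<subseteq> carrier G"
  shows "word_eval G S \<in> hom (free_group (length S)) G"
proof (rule homI)
  fix u v assume "u \<in> carrier (free_group (length S))" "v \<in> carrier (free_group (length S))"
  then have "u \<in> reduced_words (length S)" and v: "v \<in> reduced_words (length S)"
    by (simp_all add: free_group_def)
  then have "word_eval G S (foldr cons_reduce u v) = word_eval G S u \<otimes> word_eval G S v"
  proof (induction u)
    case Nil
    then show ?case using word_eval_closed[OF assms] by (simp add: word_eval_def)
  next
    case (Cons a u)
    then have a: "fst a < length S" and u: "u \<in> reduced_words (length S)"
      by (auto dest: Cons_reduced_words)
    have *: "word_eval G S (a # w) =
        (if snd a then S ! fst a else inv (S ! fst a)) \<otimes> word_eval G S w" for w
      by (simp add: word_eval_def split_beta)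
    have "word_eval G S (foldr cons_reduce (a # u) v)
        = word_eval G S (a # foldr cons_reduce u v)"
      using word_eval_cons_reduce[OF assms foldr_cons_reduce_reduced[OF u v] a] by simp
    with Cons.IH[OF u v] letter_eval_closed[OF assms a] word_eval_closed[OF assms u]
      word_eval_closed[OF assms v]
    show ?case by (simp add: * m_assoc)
  qed
  then show "word_eval G S (u \<otimes>\<^bsub>free_group (length S)\<^esub> v) = word_eval G S u \<otimes> word_eval G S v"
    by (simp add: free_group_def)
qed (auto simp: free_group_def word_eval_closed[OF assms])

end

definition marked_group :: "nat \<Rightarrow> ('a, 'm) monoid_scheme \<Rightarrow> 'a list \<Rightarrow> bool" where
  "marked_group n G S \<longleftrightarrow>
     group G \<and> length S = n \<and> set S \<subseteq> carrier G \<and> generate G (set S) = carrier G"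

text \<open>The normal subgroup of the free group which represents the marked group \<open>(G, S)\<close>.
  Working with it implements the identification of marked groups that are isomorphic via
  \<open>S ! i \<mapsto> S' ! i\<close>; it also allows the groups to live on different types.\<close>

definition marked_kernel :: "('a, 'm) monoid_scheme \<Rightarrow> 'a list \<Rightarrow> letter list set" where
  "marked_kernel G S = kernel (free_group (length S)) G (word_eval G S)"

text \<open>The topology on the set of normal subgroups of the free group is induced, via indicator
  functions, by the product topology on functions from the free group to the discrete
  two-point space.\<close>

definition marked_group_space :: "nat \<Rightarrow> letter list set topology" where
  "marked_group_space n =
     pullback_topology {N. N \<lhd> free_group n} (\<lambda>N. \<lambda>w\<in>carrier (free_group n). w \<in> N)
       (product_topology (\<lambda>_. discrete_topology (UNIV :: bool set)) (carrier (free_group n)))"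

definition marked_converges ::
  "nat \<Rightarrow> (nat \<Rightarrow> ('a, 'm) monoid_scheme) \<Rightarrow> (nat \<Rightarrow> 'a list) \<Rightarrow>
   ('b, 'k) monoid_scheme \<Rightarrow> 'b list \<Rightarrow> bool" where
  "marked_converges n Gs Ss G S \<longleftrightarrow>
     limitin (marked_group_space n) (\<lambda>k. marked_kernel (Gs k) (Ss k)) (marked_kernel G S) sequentially"

definition marked_accumulates ::
  "nat \<Rightarrow> (nat \<Rightarrow> ('a, 'm) monoid_scheme) \<Rightarrow> (nat \<Rightarrow> 'a list) \<Rightarrow>
   ('b, 'k) monoid_scheme \<Rightarrow> 'b list \<Rightarrow> bool" where
  "marked_accumulates n Gs Ss G S \<longleftrightarrow>
     (\<exists>r :: nat \<Rightarrow> nat. strict_mono r \<and> marked_converges n (Gs \<circ> r) (Ss \<circ> r) G S)"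

lemma topspace_marked_group_space: "topspace (marked_group_space n) = {N. N \<lhd> free_group n}"
  by (auto simp: marked_group_space_def topspace_pullback_topology)

lemma marked_kernel_in_space:
  assumes "marked_group n G S"
  shows "marked_kernel G S \<in> topspace (marked_group_space n)"
proof -
  have "group_hom (free_group n) G (word_eval G S)"
    using assms group.word_eval_hom[of G S] group_free_group[of n]
    by (auto simp: group_hom_def group_hom_axioms_def marked_group_def)
  then show ?thesis
    using assms group_hom.normal_kernel
    by (auto simp: topspace_marked_group_space marked_kernel_def marked_group_def)
qed

definition ultrafilter_measure :: "(nat set \<Rightarrow> real) \<Rightarrow> bool" where
  "ultrafilter_measure \<omega> \<longleftrightarrow> range \<omega> \<subseteq> {0, 1} \<and> additive UNIV \<omega> \<and> \<omega> UNIV = 1"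

definition nonprincipal :: "(nat set \<Rightarrow> real) \<Rightarrow> bool" where
  "nonprincipal \<omega> \<longleftrightarrow> (\<forall>A. finite A \<longrightarrow> \<omega> A = 0)"

definition ae_equal ::
  "(nat set \<Rightarrow> real) \<Rightarrow> (nat \<Rightarrow> ('a, 'm) monoid_scheme) \<Rightarrow> ((nat \<Rightarrow> 'a) \<times> (nat \<Rightarrow> 'a)) set" where
  "ae_equal \<omega> Gs =
     {(f, g). f \<in> carrier (product_group UNIV Gs) \<and> g \<in> carrier (product_group UNIV Gs) \<and>
              \<omega> {k. f k = g k} = 1}"

definition ultraproduct ::
  "(nat set \<Rightarrow> real) \<Rightarrow> (nat \<Rightarrow> ('a, 'm) monoid_scheme) \<Rightarrow> (nat \<Rightarrow> 'a) set monoid" where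
  "ultraproduct \<omega> Gs =
     \<lparr>carrier = carrier (product_group UNIV Gs) // ae_equal \<omega> Gs,
      monoid.mult = (\<lambda>A B. \<Union>f\<in>A. \<Union>g\<in>B. ae_equal \<omega> Gs `` {f \<otimes>\<^bsub>product_group UNIV Gs\<^esub> g}),
      one = ae_equal \<omega> Gs `` {\<one>\<^bsub>product_group UNIV Gs\<^esub>}\<rparr>"

lemma ultrafilter_measure_Un:
  assumes "ultrafilter_measure \<omega>" "C \<inter> D = {}"
  shows "\<omega> (C \<union> D) = \<omega> C + \<omega> D"
  using assms unfolding ultrafilter_measure_def additive_def by simp

lemma ultrafilter_measure_values:
  "ultrafilter_measure \<omega> \<Longrightarrow> \<omega> C = 0 \<or> \<omega> C = 1"
  unfolding ultrafilter_measure_def by blast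

lemma ultrafilter_measure_mono:
  assumes "ultrafilter_measure \<omega>" "\<omega> C = 1" "C \<subseteq> D"
  shows "\<omega> D = 1"
proof -
  have "\<omega> (C \<union> (D - C)) = \<omega> C + \<omega> (D - C)"
    by (rule ultrafilter_measure_Un[OF assms(1)]) blast
  moreover have "C \<union> (D - C) = D" using assms(3) by blast
  ultimately show ?thesis
    using ultrafilter_measure_values[OF assms(1), of D]
      ultrafilter_measure_values[OF assms(1), of "D - C"] assms(2) by force
qed

lemma ultrafilter_measure_Int:
  assumes "ultrafilter_measure \<omega>" "\<omega> C = 1" "\<omega> D = 1"
  shows "\<omega> (C \<inter> D) = 1"
proof -
  have "\<omega> ((C \<inter> D) \<union> (C - D)) = \<omega> (C \<inter> D) + \<omega> (C - D)"
    by (rule ultrafilter_measure_Un[OF assms(1)]) blast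
  moreover have "(C \<inter> D) \<union> (C - D) = C" by blast
  moreover have "\<omega> (D \<union> (C - D)) = \<omega> D + \<omega> (C - D)"
    by (rule ultrafilter_measure_Un[OF assms(1)]) blast
  ultimately show ?thesis
    using ultrafilter_measure_values[OF assms(1), of "D \<union> (C - D)"]
      ultrafilter_measure_values[OF assms(1), of "C - D"] assms(2,3) by force
qed

lemma equiv_ae_equal:
  assumes "ultrafilter_measure \<omega>"
  shows "equiv (carrier (product_group UNIV Gs)) (ae_equal \<omega> Gs)"
proof (rule equivI)
  show "refl_on (carrier (product_group UNIV Gs)) (ae_equal \<omega> Gs)"
    using assms by (auto simp: refl_on_def ae_equal_def ultrafilter_measure_def)
  show "sym (ae_equal \<omega> Gs)"
  proof (rule symI)
    fix f g assume *: "(f, g) \<in> ae_equal \<omega> Gs"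
    have "{k. g k = f k} = {k. f k = g k}" by metis
    with * show "(g, f) \<in> ae_equal \<omega> Gs" by (simp add: ae_equal_def)
  qed
  show "trans (ae_equal \<omega> Gs)"
  proof (rule transI)
    fix f g h assume *: "(f, g) \<in> ae_equal \<omega> Gs" "(g, h) \<in> ae_equal \<omega> Gs"
    have "\<omega> ({k. f k = g k} \<inter> {k. g k = h k}) = 1"
      using * by (intro ultrafilter_measure_Int[OF assms]) (auto simp: ae_equal_def)
    then have "\<omega> {k. f k = h k} = 1"
      by (rule ultrafilter_measure_mono[OF assms]) auto
    with * show "(f, h) \<in> ae_equal \<omega> Gs" by (auto simp: ae_equal_def)
  qed
qed (auto simp: ae_equal_def)

lemma ultraproduct_mult:
  assumes "ultrafilter_measure \<omega>" "\<And>k. group (Gs k)"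
    and "f \<in> carrier (product_group UNIV Gs)" "g \<in> carrier (product_group UNIV Gs)"
  shows "ae_equal \<omega> Gs `` {f} \<otimes>\<^bsub>ultraproduct \<omega> Gs\<^esub> ae_equal \<omega> Gs `` {g}
       = ae_equal \<omega> Gs `` {f \<otimes>\<^bsub>product_group UNIV Gs\<^esub> g}"
proof -
  interpret P: group "product_group UNIV Gs" using assms(2) by simp
  have "(\<lambda>f g. ae_equal \<omega> Gs `` {f \<otimes>\<^bsub>product_group UNIV Gs\<^esub> g}) respects2 ae_equal \<omega> Gs"
  proof (rule congruent2I')
    fix f f' g g' assume *: "(f, f') \<in> ae_equal \<omega> Gs" "(g, g') \<in> ae_equal \<omega> Gs"
    have "\<omega> ({k. f k = f' k} \<inter> {k. g k = g' k}) = 1"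
      using * by (intro ultrafilter_measure_Int[OF assms(1)]) (auto simp: ae_equal_def)
    then have "\<omega> {k. (f \<otimes>\<^bsub>product_group UNIV Gs\<^esub> g) k = (f' \<otimes>\<^bsub>product_group UNIV Gs\<^esub> g') k} = 1"
      by (rule ultrafilter_measure_mono[OF assms(1)]) auto
    moreover have "f \<otimes>\<^bsub>product_group UNIV Gs\<^esub> g \<in> carrier (product_group UNIV Gs)"
      "f' \<otimes>\<^bsub>product_group UNIV Gs\<^esub> g' \<in> carrier (product_group UNIV Gs)"
      using * unfolding ae_equal_def by blast+
    ultimately show "ae_equal \<omega> Gs `` {f \<otimes>\<^bsub>product_group UNIV Gs\<^esub> g}
        = ae_equal \<omega> Gs `` {f' \<otimes>\<^bsub>product_group UNIV Gs\<^esub> g'}"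
      by (intro equiv_class_eq[OF equiv_ae_equal[OF assms(1)]]) (simp add: ae_equal_def)
  qed
  from UN_equiv_class2[OF equiv_ae_equal[OF assms(1)] equiv_ae_equal[OF assms(1)] this assms(3,4)]
  show ?thesis by (simp add: ultraproduct_def)
qed

lemma group_ultraproduct:
  assumes "ultrafilter_measure \<omega>" "\<And>k. group (Gs k)"
  shows "group (ultraproduct \<omega> Gs)"
proof -
  define P where "P = product_group UNIV Gs"
  interpret P: group P using assms(2) by (simp add: P_def)
  define cls where "cls = (\<lambda>f. ae_equal \<omega> Gs `` {f})"
  have car: "carrier (ultraproduct \<omega> Gs) = cls ` carrier P"
    by (auto simp: ultraproduct_def quotient_def cls_def P_def)
  have one: "\<one>\<^bsub>ultraproduct \<omega> Gs\<^esub> = cls \<one>\<^bsub>P\<^esub>"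
    by (simp add: ultraproduct_def cls_def P_def)
  have mult: "cls f \<otimes>\<^bsub>ultraproduct \<omega> Gs\<^esub> cls g = cls (f \<otimes>\<^bsub>P\<^esub> g)"
    if "f \<in> carrier P" "g \<in> carrier P" for f g
    using ultraproduct_mult[of \<omega> Gs f g] assms that by (simp add: cls_def P_def)
  show ?thesis
  proof (rule groupI)
    fix x assume "x \<in> carrier (ultraproduct \<omega> Gs)"
    then obtain f where f: "f \<in> carrier P" "x = cls f" by (auto simp: car)
    then show "\<exists>y\<in>carrier (ultraproduct \<omega> Gs). y \<otimes>\<^bsub>ultraproduct \<omega> Gs\<^esub> x = \<one>\<^bsub>ultraproduct \<omega> Gs\<^esub>"
      by (intro bexI[of _ "cls (inv\<^bsub>P\<^esub> f)"]) (auto simp: car one mult)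
  qed (auto simp: car one mult P.m_assoc)
qed

end

theory Submission
  imports Defs
begin

text \<open>Convergence in the space of marked groups means that the membership of each word in the
  kernels is eventually constant.  By Los's theorem for the atomic formulas \<open>w = 1\<close>, the kernel of
  a tuple in an ultraproduct consists of the words lying in \<open>\<omega>\<close>-almost all of the coordinate
  kernels.  Marking the ultraproduct by the classes of the sequences of \<open>i\<close>-th generators thus
  yields the kernel of the limit group, which gives the embedding; for an accumulation point one
  pushes an ultrafilter forward along the subsequence.  Conversely, representatives of the
  generators of a subgroup generate subgroups of the \<open>G\<^sub>k\<close>, and since there are only countably
  many words, a diagonal argument extracts an ordinary convergent subsequence from the
  \<open>\<omega>\<close>-convergence of their kernels.\<close>

section \<open>Convergence in the space of marked groups\<close>

text \<open>The open sets of the pullback are the intersections with \<open>A\<close> of preimages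
  of open sets, so neighbourhoods of \<open>l\<close> come from neighbourhoods of
  \<open>f l\<close>. Points outside \<open>A\<close> can still have images near \<open>f l\<close>,
  hence the separate clause on \<open>g x\<close>.\<close>

lemma limitin_pullback_topology:
  "limitin (pullback_topology A f T) g l F \<longleftrightarrow>
     l \<in> A \<and> (\<forall>\<^sub>F x in F. g x \<in> A) \<and> limitin T (\<lambda>x. f (g x)) (f l) F"
  (is "?L \<longleftrightarrow> ?R")
proof
  assume L: ?L
  then have l: "l \<in> A" "f l \<in> topspace T"
    by (auto dest!: limitin_topspace simp: topspace_pullback_topology)
  have ev: "\<forall>\<^sub>F x in F. f (g x) \<in> U \<and> g x \<in> A" if "openin T U" "f l \<in> U" for U
  proof -
    have "openin (pullback_topology A f T) (f -` U \<inter> A)"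
      using that(1) by (auto simp: openin_pullback_topology)
    with L l(1) that(2) have "\<forall>\<^sub>F x in F. g x \<in> f -` U \<inter> A"
      unfolding limitin_def by blast
    then show ?thesis by eventually_elim simp
  qed
  \<comment> \<open>The instance of \<open>ev\<close> for the whole space gives the clause on
    \<open>A\<close>.\<close>
  show ?R
    using l ev[of "topspace T"] ev by (auto simp: limitin_def eventually_conj_iff)
next
  assume R: ?R
  show ?L
    unfolding limitin_def
  proof (intro conjI allI impI)
    show "l \<in> topspace (pullback_topology A f T)"
      using R by (auto dest!: limitin_topspace simp: topspace_pullback_topology)
    fix V assume "openin (pullback_topology A f T) V \<and> l \<in> V"
    then obtain U where U: "openin T U" "V = f -` U \<inter> A" "f l \<in> U"
      by (auto simp: openin_pullback_topology)
    then have "\<forall>\<^sub>F x in F. f (g x) \<in> U" using R by (auto simp: limitin_def)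
    with R show "\<forall>\<^sub>F x in F. g x \<in> V" by (auto simp: U elim: eventually_elim2)
  qed
qed

lemma limitin_discrete_topology:
  "limitin (discrete_topology U) f l F \<longleftrightarrow> l \<in> U \<and> (\<forall>\<^sub>F x in F. f x = l)"
  (is "?L \<longleftrightarrow> ?R")
proof
  assume ?L
  then have "l \<in> U"
    and *: "openin (discrete_topology U) {l} \<and> l \<in> {l} \<longrightarrow> (\<forall>\<^sub>F x in F. f x \<in> {l})"
    unfolding limitin_def by (simp, blast)
  then show ?R by simp
next
  assume ?R
  then show ?L by (auto simp: limitin_def elim: eventually_mono)
qed

text \<open>Convergence in a product is componentwise, and in a discrete factor it means being
  eventually equal to the limit. From here on the topology enters only through this
  criterion.\<close>

lemma marked_converges_iff:
  assumes "\<And>k. marked_group n (Gs k) (Ss k)" "marked_group n G S"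
  shows "marked_converges n Gs Ss G S \<longleftrightarrow>
    (\<forall>w\<in>reduced_words n. \<forall>\<^sub>F k in sequentially.
       w \<in> marked_kernel (Gs k) (Ss k) \<longleftrightarrow> w \<in> marked_kernel G S)"
  using marked_kernel_in_space[OF assms(1)] marked_kernel_in_space[OF assms(2)]
  by (simp add: marked_converges_def marked_group_space_def limitin_pullback_topology
      limitin_componentwise limitin_discrete_topology free_group_def
      topspace_pullback_topology PiE_iff)

section \<open>Non-principal ultrafilters on the natural numbers\<close>

text \<open>An ultrafilter is a cluster point, in the compact space of \<open>{0, 1}\<close>-valued functions on
  the power set of the naturals, of the sequence of point masses.\<close>

lemma nonprincipal_ultrafilter_exists:
  "\<exists>\<omega>. ultrafilter_measure \<omega> \<and> nonprincipal \<omega>"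
proof -
  define K :: "(nat set \<Rightarrow> real) set" where "K = (\<Pi>\<^sub>E A\<in>UNIV. {0, 1})"
  define \<delta> :: "nat \<Rightarrow> nat set \<Rightarrow> real" where "\<delta> = (\<lambda>k A. indicator A k)"
  define F where "F = filtermap \<delta> sequentially"
  \<comment> \<open>Tychonoff's theorem for a power of the two-point space.\<close>
  have "compactin (product_topology (\<lambda>_. euclidean) UNIV) K"
    unfolding K_def compactin_PiE by simp
  then have "compact K"
    by (simp add: euclidean_product_topology)
  moreover have "F \<noteq> bot" by (simp add: F_def filtermap_bot_iff)
  moreover have FK: "\<forall>\<^sub>F f in F. f \<in> K"
    unfolding F_def eventually_filtermap K_def \<delta>_def
    by (intro always_eventually allI PiE_I) (auto simp: indicator_def)
  ultimately obtain \<omega> where \<omega>: "\<omega> \<in> K" "inf (nhds \<omega>) F \<noteq> bot"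
    by (auto simp: compact_filter)
  \<comment> \<open>A proper filter finer than \<open>F\<close> that converges to \<omega>; all
    properties of \<omega> are obtained as limits along it.\<close>
  define F' where "F' = inf (nhds \<omega>) F"
  have lim: "((\<lambda>f. f A) \<longlongrightarrow> \<omega> A) F'" for A
  proof -
    have "((\<lambda>f. f) \<longlongrightarrow> \<omega>) F'"
      by (simp add: filterlim_def F'_def)
    from continuous_on_tendsto_compose[OF continuous_on_product_coordinates this]
    show ?thesis by simp
  qed
  have ev: "\<forall>\<^sub>F f in F'. P f" if "\<forall>\<^sub>F k in sequentially. P (\<delta> k)" for P
    using that by (simp add: F'_def F_def eventually_inf eventually_filtermap)
      (metis (mono_tags, lifting) eventually_True eventually_filtermap)
  \<comment> \<open>Limits along a proper filter are unique, so a coordinate that is eventually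
    constant on the point masses has the same value at \<omega>.\<close>
  have eq: "\<omega> A = c" if "\<forall>\<^sub>F k in sequentially. \<delta> k A = c" for A c
    using tendsto_unique[OF _ lim tendsto_eventually[OF ev[OF that]]] \<omega>(2)
    by (simp add: F'_def)
  \<comment> \<open>Each point mass is additive on disjoint sets, and this identity between three
    coordinates survives in the limit.\<close>
  have "\<omega> (A \<union> B) = \<omega> A + \<omega> B" if "A \<inter> B = {}" for A B
  proof (rule tendsto_unique[OF _ lim])
    show "((\<lambda>f. f (A \<union> B)) \<longlongrightarrow> \<omega> A + \<omega> B) F'"
    proof (rule Lim_transform_eventually)
      show "((\<lambda>f. f A + f B) \<longlongrightarrow> \<omega> A + \<omega> B) F'" by (intro tendsto_add lim)
      show "\<forall>\<^sub>F f in F'. f A + f B = f (A \<union> B)"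
        by (rule ev, rule always_eventually)
          (use that in \<open>auto simp: \<delta>_def indicator_def\<close>)
    qed
  qed (use \<omega>(2) in \<open>simp add: F'_def\<close>)
  moreover have "\<omega> UNIV = 1" by (rule eq) (simp add: \<delta>_def)
  moreover have "\<omega> A = 0" if "finite A" for A
  proof (rule eq)
    have "\<forall>\<^sub>F k in sequentially. k \<notin> A"
      using that by (simp add: cofinite_eq_sequentially[symmetric] eventually_cofinite)
    then show "\<forall>\<^sub>F k in sequentially. \<delta> k A = 0"
      by eventually_elim (simp add: \<delta>_def)
  qed
  ultimately show ?thesis
    using \<omega>(1)
    by (intro exI[of _ \<omega>])
       (auto simp: K_def ultrafilter_measure_def nonprincipal_def additive_def PiE_iff)
qed

lemma ultrafilter_measure_Compl:
  assumes "ultrafilter_measure \<omega>"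
  shows "\<omega> (- A) = 1 - \<omega> A"
proof -
  have "\<omega> (A \<union> - A) = \<omega> A + \<omega> (- A)"
    by (rule ultrafilter_measure_Un[OF assms]) simp
  with assms show ?thesis by (simp add: ultrafilter_measure_def)
qed

text \<open>The exceptional set is finite, hence null.\<close>

lemma ultrafilter_measure_eventually:
  assumes "ultrafilter_measure \<omega>" "nonprincipal \<omega>" "\<forall>\<^sub>F k in sequentially. P k"
  shows "\<omega> {k. P k} = 1"
proof -
  have "finite (- {k. P k})"
    using assms(3)
    by (simp add: cofinite_eq_sequentially[symmetric] eventually_cofinite Collect_neg_eq)
  with assms(2) have "\<omega> (- {k. P k}) = 0" by (simp add: nonprincipal_def)
  with ultrafilter_measure_Compl[OF assms(1), of "{k. P k}"] show ?thesis by simp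
qed

lemma ultrafilter_measure_INT:
  assumes "ultrafilter_measure \<omega>" "finite I" "\<And>i. i \<in> I \<Longrightarrow> \<omega> (A i) = 1"
  shows "\<omega> (\<Inter>i\<in>I. A i) = 1"
  using assms(2,3)
proof (induction I)
  case empty
  then show ?case using assms(1) by (simp add: ultrafilter_measure_def)
qed (simp add: ultrafilter_measure_Int[OF assms(1)])

text \<open>If \<open>Q\<close> fails, then \<open>P\<close> fails on a set of measure one, whose
  complement is null. Used to read membership in the limit kernel off agreement almost
  everywhere.\<close>

lemma ultrafilter_measure_iff:
  assumes "ultrafilter_measure \<omega>" "\<omega> {k. P k \<longleftrightarrow> Q} = 1"
  shows "\<omega> {k. P k} = 1 \<longleftrightarrow> Q"
proof (cases Q)
  case False
  then have "\<omega> {k. P k} = 0"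
    using assms ultrafilter_measure_Compl[OF assms(1), of "{k. P k}"]
    by (simp add: Collect_neg_eq[symmetric])
  with False show ?thesis by simp
qed (use assms in simp)

text \<open>This is the push-forward along \<open>r\<close>; preimages commute with unions and
  preserve disjointness.\<close>

lemma ultrafilter_measure_vimage:
  "ultrafilter_measure \<omega> \<Longrightarrow> ultrafilter_measure (\<lambda>A. \<omega> (r -` A))"
  unfolding ultrafilter_measure_def additive_def
  by (auto simp: vimage_Int[symmetric])

lemma nonprincipal_vimage:
  "nonprincipal \<omega> \<Longrightarrow> inj r \<Longrightarrow> nonprincipal (\<lambda>A. \<omega> (r -` A))"
  by (simp add: nonprincipal_def finite_vimageI)

section \<open>Word evaluation and marked kernels\<close>

lemma Cons_word_eval:
  "word_eval G S (a # w) =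
     (if snd a then S ! fst a else inv\<^bsub>G\<^esub> (S ! fst a)) \<otimes>\<^bsub>G\<^esub> word_eval G S w"
  by (simp add: word_eval_def split_beta)

text \<open>Applied below to the inclusion of a subgroup, to the coordinate projections of the
  direct product and to the class map onto the ultraproduct.\<close>

lemma (in group_hom) word_eval_map:
  assumes "set S \<subseteq> carrier G" "w \<in> reduced_words (length S)"
  shows "word_eval H (map h S) w = h (word_eval G S w)"
  using assms(2)
proof (induction w)
  case Nil
  then show ?case by (simp add: word_eval_def)
next
  case (Cons a w)
  then have a: "fst a < length S" and w: "w \<in> reduced_words (length S)"
    by (auto dest: Cons_reduced_words)
  with Cons.IH assms(1) show ?case
    by (simp add: Cons_word_eval G.word_eval_closed G.letter_eval_closed)
qed

lemma mem_marked_kernel: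
  "w \<in> marked_kernel G S \<longleftrightarrow> w \<in> reduced_words (length S) \<and> word_eval G S w = \<one>\<^bsub>G\<^esub>"
  by (simp add: marked_kernel_def kernel_def free_group_def)

lemma marked_kernel_subgroup:
  assumes "group G" "subgroup H G" "set S \<subseteq> H"
  shows "marked_kernel (G\<lparr>carrier := H\<rparr>) S = marked_kernel G S"
proof -
  interpret group G by fact
  interpret group_hom "G\<lparr>carrier := H\<rparr>" G "\<lambda>x. x"
    using assms subgroup.subgroup_is_group[of H G]
    by (auto simp: group_hom_def group_hom_axioms_def hom_def dest: subgroup.mem_carrier)
  show ?thesis
    using word_eval_map[of S] assms(3) by (auto simp: mem_marked_kernel)
qed

text \<open>The image is a subgroup, and it contains every generator as the value of a one-letter
  word.\<close>

lemma word_eval_surj: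
  assumes "marked_group n G S"
  shows "word_eval G S ` reduced_words n = carrier G"
proof -
  interpret group G using assms by (simp add: marked_group_def)
  have S: "length S = n" "set S \<subseteq> carrier G" "generate G (set S) = carrier G"
    using assms by (auto simp: marked_group_def)
  interpret hom: group_hom "free_group n" G "word_eval G S"
    using word_eval_hom[OF S(2)] group_free_group S(1)
    by (simp add: group_hom_def group_hom_axioms_def is_group)
  have "set S \<subseteq> word_eval G S ` reduced_words n"
  proof
    fix s assume "s \<in> set S"
    then obtain i where i: "i < n" "s = S ! i" using S(1) by (metis in_set_conv_nth)
    moreover have "s \<in> carrier G" using \<open>s \<in> set S\<close> S(2) by blast
    ultimately have "word_eval G S [(i, True)] = s"
      by (simp add: word_eval_def)
    moreover have "[(i, True)] \<in> reduced_words n" using i by (simp add: reduced_words_def)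
    ultimately show "s \<in> word_eval G S ` reduced_words n" by blast
  qed
  moreover have "subgroup (word_eval G S ` reduced_words n) G"
    using hom.img_is_subgroup by (simp add: free_group_def)
  ultimately have "generate G (set S) \<subseteq> word_eval G S ` reduced_words n"
    by (rule generate_subgroup_incl)
  with S word_eval_closed[OF S(2)] show ?thesis by auto
qed

text \<open>Equal kernels give the two evaluation maps the same fibres. Hence choosing a word for an
  element of \<open>G\<close> and evaluating it at \<open>T\<close> is a well-defined injective
  homomorphism.\<close>

lemma mon_of_marked_kernel_eq:
  assumes "marked_group n G S" "group U" "set T \<subseteq> carrier U" "length T = n"
    and "marked_kernel G S = marked_kernel U T"
  shows "\<exists>h. h \<in> mon G U"
proof -
  interpret G: group G using assms(1) by (simp add: marked_group_def)
  interpret U: group U by fact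
  have S: "length S = n" "set S \<subseteq> carrier G" using assms(1) by (auto simp: marked_group_def)
  let ?F = "free_group n" and ?g = "word_eval G S" and ?u = "word_eval U T"
  interpret g: group_hom ?F G ?g
    using G.word_eval_hom[OF S(2)] group_free_group S(1)
    by (simp add: group_hom_def group_hom_axioms_def G.is_group)
  interpret u: group_hom ?F U ?u
    using U.word_eval_hom[OF assms(3)] group_free_group assms(4)
    by (simp add: group_hom_def group_hom_axioms_def U.is_group)
  have surj: "?g ` carrier ?F = carrier G"
    using word_eval_surj[OF assms(1)] by (simp add: free_group_def)
  have ker: "?g w = \<one>\<^bsub>G\<^esub> \<longleftrightarrow> ?u w = \<one>\<^bsub>U\<^esub>" if "w \<in> carrier ?F" for w
    using assms(5) that S(1) assms(4) by (auto simp: mem_marked_kernel free_group_def set_eq_iff)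
  have eq: "?g v = ?g w \<longleftrightarrow> ?u v = ?u w" if v: "v \<in> carrier ?F" and w: "w \<in> carrier ?F" for v w
  proof -
    have "?g v = ?g w \<longleftrightarrow> ?g (v \<otimes>\<^bsub>?F\<^esub> inv\<^bsub>?F\<^esub> w) = \<one>\<^bsub>G\<^esub>"
      using v w G.inv_equality[of "?g v" "inv\<^bsub>G\<^esub> ?g w"] by (auto simp: G.inv_solve_right')
    also have "\<dots> \<longleftrightarrow> ?u (v \<otimes>\<^bsub>?F\<^esub> inv\<^bsub>?F\<^esub> w) = \<one>\<^bsub>U\<^esub>"
      using v w by (intro ker) simp
    also have "\<dots> \<longleftrightarrow> ?u v = ?u w"
      using v w U.inv_equality[of "?u v" "inv\<^bsub>U\<^esub> ?u w"] by (auto simp: U.inv_solve_right')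
    finally show ?thesis .
  qed
  \<comment> \<open>A set-theoretic section of the evaluation in \<open>G\<close>. It need not be
    multiplicative, but by \<open>eq\<close> the value in \<open>U\<close> does not depend on the
    chosen word.\<close>
  define r where "r = inv_into (carrier ?F) ?g"
  have r: "r x \<in> carrier ?F" "?g (r x) = x" if "x \<in> carrier G" for x
    using that surj by (auto simp: r_def inv_into_into f_inv_into_f)
  have "(\<lambda>x. ?u (r x)) \<in> hom G U"
  proof (rule homI)
    fix x y assume xy: "x \<in> carrier G" "y \<in> carrier G"
    then have "?g (r (x \<otimes>\<^bsub>G\<^esub> y)) = ?g (r x \<otimes>\<^bsub>?F\<^esub> r y)" by (simp add: r)
    with xy have "?u (r (x \<otimes>\<^bsub>G\<^esub> y)) = ?u (r x \<otimes>\<^bsub>?F\<^esub> r y)" by (subst eq[symmetric]) (simp_all add: r)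
    with xy show "?u (r (x \<otimes>\<^bsub>G\<^esub> y)) = ?u (r x) \<otimes>\<^bsub>U\<^esub> ?u (r y)" by (simp add: r)
  qed (simp add: r)
  moreover have "inj_on (\<lambda>x. ?u (r x)) (carrier G)"
    by (rule inj_onI) (metis eq r)
  ultimately show ?thesis unfolding mon_def by blast
qed

section \<open>Embeddings into ultraproducts\<close>

lemma ultraproduct_group_hom:
  assumes "ultrafilter_measure \<omega>" "\<And>k. group (Gs k)"
  shows "group_hom (product_group UNIV Gs) (ultraproduct \<omega> Gs) (\<lambda>f. ae_equal \<omega> Gs `` {f})"
proof -
  have "(\<lambda>f. ae_equal \<omega> Gs `` {f}) \<in> hom (product_group UNIV Gs) (ultraproduct \<omega> Gs)"
  proof (rule homI)
    fix f g assume "f \<in> carrier (product_group UNIV Gs)" "g \<in> carrier (product_group UNIV Gs)"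
    from ultraproduct_mult[OF assms this]
    show "ae_equal \<omega> Gs `` {f \<otimes>\<^bsub>product_group UNIV Gs\<^esub> g} =
        ae_equal \<omega> Gs `` {f} \<otimes>\<^bsub>ultraproduct \<omega> Gs\<^esub> ae_equal \<omega> Gs `` {g}" by (rule sym)
  qed (simp add: ultraproduct_def quotientI)
  then show ?thesis
    using assms group_ultraproduct[OF assms]
    by (simp add: group_hom_def group_hom_axioms_def)
qed

text \<open>The class map commutes with word evaluation, so the word is trivial exactly when its
  value in the direct product is almost everywhere the identity; the projections compute that value
  coordinatewise.\<close>

lemma mem_marked_kernel_ultraproduct:
  assumes "ultrafilter_measure \<omega>" "\<And>k. group (Gs k)"
    and "set fs \<subseteq> carrier (product_group UNIV Gs)"
  shows "w \<in> marked_kernel (ultraproduct \<omega> Gs) (map (\<lambda>f. ae_equal \<omega> Gs `` {f}) fs) \<longleftrightarrow>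
    w \<in> reduced_words (length fs) \<and>
    \<omega> {k. w \<in> marked_kernel (Gs k) (map (\<lambda>f. f k) fs)} = 1"
proof (cases "w \<in> reduced_words (length fs)")
  case True
  let ?P = "product_group UNIV Gs" and ?cls = "\<lambda>f. ae_equal \<omega> Gs `` {f}"
  interpret cls: group_hom ?P "ultraproduct \<omega> Gs" ?cls
    by (rule ultraproduct_group_hom[OF assms(1,2)])
  have proj: "group_hom ?P (Gs k) (\<lambda>f. f k)" for k
    using assms(2) by (auto simp: group_hom_def group_hom_axioms_def hom_def)
  have car: "word_eval ?P fs w \<in> carrier ?P"
    by (rule cls.G.word_eval_closed[OF assms(3) True])
  have "?cls (word_eval ?P fs w) = \<one>\<^bsub>ultraproduct \<omega> Gs\<^esub> \<longleftrightarrow>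
      (word_eval ?P fs w, \<one>\<^bsub>?P\<^esub>) \<in> ae_equal \<omega> Gs"
    using eq_equiv_class_iff[OF equiv_ae_equal[OF assms(1)] car cls.G.one_closed]
    by (simp add: ultraproduct_def)
  also have "\<dots> \<longleftrightarrow> \<omega> {k. word_eval ?P fs w k = \<one>\<^bsub>Gs k\<^esub>} = 1"
    using car cls.G.one_closed by (simp add: ae_equal_def)
  also have "{k. word_eval ?P fs w k = \<one>\<^bsub>Gs k\<^esub>} =
      {k. w \<in> marked_kernel (Gs k) (map (\<lambda>f. f k) fs)}"
    using True group_hom.word_eval_map[OF proj assms(3) True] by (simp add: mem_marked_kernel)
  finally show ?thesis
    using True cls.word_eval_map[OF assms(3) True] by (simp add: mem_marked_kernel)
qed (simp add: mem_marked_kernel)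

text \<open>The limit hypothesis is phrased through \<omega> alone, so that it covers both
  convergent sequences and push-forwards along a subsequence.\<close>

lemma ultraproduct_embedding:
  assumes "\<And>k. marked_group n (Gs k) (Ss k)" "marked_group n G S" "ultrafilter_measure \<omega>"
    and lim: "\<And>w. w \<in> reduced_words n \<Longrightarrow>
      \<omega> {k. w \<in> marked_kernel (Gs k) (Ss k) \<longleftrightarrow> w \<in> marked_kernel G S} = 1"
  shows "\<exists>h. h \<in> mon G (ultraproduct \<omega> Gs)"
proof -
  have Gs: "group (Gs k)" and len: "length (Ss k) = n" and sub: "set (Ss k) \<subseteq> carrier (Gs k)" for k
    using assms(1) by (auto simp: marked_group_def)
  \<comment> \<open>The transpose of \<open>Ss\<close>: entry \<open>i\<close> is the sequence of
    generators with index \<open>i\<close>.\<close>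
  define fs where "fs = map (\<lambda>i k. Ss k ! i) [0..<n]"
  have Ss: "map (\<lambda>f. f k) fs = Ss k" for k
    using len by (intro nth_equalityI) (simp_all add: fs_def)
  have fs: "set fs \<subseteq> carrier (product_group UNIV Gs)" "length fs = n"
    using sub len by (auto simp: fs_def PiE_iff subset_iff)
  let ?T = "map (\<lambda>f. ae_equal \<omega> Gs `` {f}) fs"
  interpret cls: group_hom "product_group UNIV Gs" "ultraproduct \<omega> Gs" "\<lambda>f. ae_equal \<omega> Gs `` {f}"
    by (rule ultraproduct_group_hom[OF assms(3) Gs])
  have "set ?T \<subseteq> carrier (ultraproduct \<omega> Gs)"
    using fs(1) cls.hom_closed by (auto simp del: carrier_product_group)
  moreover have "marked_kernel G S = marked_kernel (ultraproduct \<omega> Gs) ?T"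
  proof (rule Set.set_eqI)
    fix w
    have "w \<in> marked_kernel G S \<longleftrightarrow>
        w \<in> reduced_words n \<and> \<omega> {k. w \<in> marked_kernel (Gs k) (Ss k)} = 1"
    proof (cases "w \<in> reduced_words n")
      case True
      then show ?thesis using ultrafilter_measure_iff[OF assms(3) lim[OF True]] by simp
    next
      case False
      then show ?thesis using assms(2) by (simp add: mem_marked_kernel marked_group_def)
    qed
    then show "w \<in> marked_kernel G S \<longleftrightarrow> w \<in> marked_kernel (ultraproduct \<omega> Gs) ?T"
      by (simp only: mem_marked_kernel_ultraproduct[OF assms(3) Gs fs(1)] Ss fs(2))
  qed
  ultimately show ?thesis
    using mon_of_marked_kernel_eq[OF assms(2) cls.H.is_group, of ?T] fs(2) by simp
qed

lemma ultraproduct_embedding_of_converges: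
  assumes "\<And>k. marked_group n (Gs k) (Ss k)" "marked_group n G S"
    and "marked_converges n Gs Ss G S" "ultrafilter_measure \<omega>" "nonprincipal \<omega>"
  shows "\<exists>h. h \<in> mon G (ultraproduct \<omega> Gs)"
proof (rule ultraproduct_embedding[OF assms(1,2,4)])
  fix w assume "w \<in> reduced_words n"
  with assms(3) show "\<omega> {k. w \<in> marked_kernel (Gs k) (Ss k) \<longleftrightarrow> w \<in> marked_kernel G S} = 1"
    by (intro ultrafilter_measure_eventually[OF assms(4,5)])
       (simp add: marked_converges_iff[OF assms(1,2)])
qed

lemma ultraproduct_embedding_of_accumulates:
  assumes "\<And>k. marked_group n (Gs k) (Ss k)" "marked_group n G S"
    and "marked_accumulates n Gs Ss G S"
  shows "\<exists>\<omega>. ultrafilter_measure \<omega> \<and> nonprincipal \<omega> \<and> (\<exists>h. h \<in> mon G (ultraproduct \<omega> Gs))"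
proof -
  obtain r :: "nat \<Rightarrow> nat" where r: "strict_mono r"
    and conv: "marked_converges n (Gs \<circ> r) (Ss \<circ> r) G S"
    using assms(3) by (auto simp: marked_accumulates_def)
  obtain \<omega> where \<omega>: "ultrafilter_measure \<omega>" "nonprincipal \<omega>"
    using nonprincipal_ultrafilter_exists by blast
  \<comment> \<open>This measure is concentrated on the range of \<open>r\<close>, where the
    convergence takes place; injectivity of \<open>r\<close> keeps it non-principal.\<close>
  let ?\<omega> = "\<lambda>A. \<omega> (r -` A)"
  have "ultrafilter_measure ?\<omega>" by (rule ultrafilter_measure_vimage[OF \<omega>(1)])
  moreover have "nonprincipal ?\<omega>"
    by (rule nonprincipal_vimage[OF \<omega>(2) strict_mono_imp_inj_on[OF r]])
  moreover have "\<exists>h. h \<in> mon G (ultraproduct ?\<omega> Gs)"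
  proof (rule ultraproduct_embedding[OF assms(1,2) \<open>ultrafilter_measure ?\<omega>\<close>])
    fix w assume "w \<in> reduced_words n"
    moreover have "marked_group n ((Gs \<circ> r) k) ((Ss \<circ> r) k)" for k by (simp add: assms(1))
    ultimately show "?\<omega> {k. w \<in> marked_kernel (Gs k) (Ss k) \<longleftrightarrow> w \<in> marked_kernel G S} = 1"
      using conv ultrafilter_measure_eventually[OF \<omega>]
      by (simp add: marked_converges_iff[OF _ assms(2)] vimage_def)
  qed
  ultimately show ?thesis by blast
qed

section \<open>Convergent sequences of subgroups\<close>

text \<open>Finitely many of the \<open>P w\<close> hold simultaneously on a set of measure one, which is infinite
  since \<open>\<omega>\<close> is non-principal.\<close>

lemma diagonal_subsequence:
  assumes "ultrafilter_measure \<omega>" "nonprincipal \<omega>" "countable W"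
    and "\<And>w. w \<in> W \<Longrightarrow> \<omega> {k. P w k} = 1"
  shows "\<exists>i :: nat \<Rightarrow> nat. strict_mono i \<and> (\<forall>w\<in>W. \<forall>\<^sub>F k in sequentially. P w (i k))"
proof (cases "W = {}")
  case True
  then show ?thesis by (intro exI[of _ id]) (simp add: strict_mono_id)
next
  case False
  then obtain e :: "nat \<Rightarrow> _" where e: "range e = W"
    using assms(3) by (metis range_from_nat_into)
  have inf: "infinite {k. \<forall>j\<le>m. P (e j) k}" for m
  proof
    assume "finite {k. \<forall>j\<le>m. P (e j) k}"
    then have "\<omega> {k. \<forall>j\<le>m. P (e j) k} = 0" using assms(2) by (simp add: nonprincipal_def)
    moreover have "{k. \<forall>j\<le>m. P (e j) k} = (\<Inter>j\<in>{..m}. {k. P (e j) k})" by auto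
    moreover have "\<omega> (\<Inter>j\<in>{..m}. {k. P (e j) k}) = 1"
      using e by (intro ultrafilter_measure_INT[OF assms(1)] assms(4)) auto
    ultimately show False by simp
  qed
  \<comment> \<open>Term \<open>m\<close> satisfies conditions \<open>0\<close> to \<open>m\<close>
    and exceeds its predecessor, so condition \<open>j\<close> holds from index \<open>j\<close>
    on.\<close>
  have "\<exists>i. \<forall>m. (\<forall>j\<le>m. P (e j) (i m)) \<and> i m < i (Suc m)"
  proof (rule dependent_nat_choice)
    show "\<exists>k. \<forall>j\<le>0. P (e j) k" using inf[of 0] not_finite_existsD by blast
    fix x m
    show "\<exists>k. (\<forall>j\<le>Suc m. P (e j) k) \<and> x < k"
      using inf[of "Suc m"] by (auto simp: infinite_nat_iff_unbounded)
  qed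
  then obtain i where i: "\<And>m j. j \<le> m \<Longrightarrow> P (e j) (i m)" "\<And>m. i m < i (Suc m)" by blast
  have "\<forall>\<^sub>F k in sequentially. P w (i k)" if "w \<in> W" for w
    using that e i(1) by (auto simp: eventually_sequentially)
  with i(2) show ?thesis by (auto simp: strict_mono_Suc_iff)
qed

text \<open>The subgroups and their markings are built at every index from representatives of
  \<open>S\<close>; only afterwards is the subsequence chosen.\<close>

lemma subgroups_converge_to_ultraproduct_subgroup:
  fixes Gs :: "nat \<Rightarrow> ('a, 'm) monoid_scheme"
  assumes "\<And>k. group (Gs k)" "ultrafilter_measure \<omega>" "nonprincipal \<omega>"
    and "subgroup G (ultraproduct \<omega> Gs)"
    and "marked_group n ((ultraproduct \<omega> Gs)\<lparr>carrier := G\<rparr>) S"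
  shows "\<exists>(i :: nat \<Rightarrow> nat) H T. strict_mono i \<and>
    (\<forall>k. subgroup (H k) (Gs k) \<and> marked_group n ((Gs k)\<lparr>carrier := H k\<rparr>) (T k)) \<and>
    marked_converges n (\<lambda>k. (Gs (i k))\<lparr>carrier := H (i k)\<rparr>) (\<lambda>k. T (i k))
      ((ultraproduct \<omega> Gs)\<lparr>carrier := G\<rparr>) S"
proof -
  let ?U = "ultraproduct \<omega> Gs" and ?P = "product_group UNIV Gs"
    and ?cls = "\<lambda>f. ae_equal \<omega> Gs `` {f}"
  have S: "length S = n" "set S \<subseteq> G" using assms(5) by (simp_all add: marked_group_def)
  have "set S \<subseteq> ?cls ` carrier ?P"
    using S(2) subgroup.subset[OF assms(4)] by (auto simp: ultraproduct_def quotient_def)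
  \<comment> \<open>Passing to lists picks representatives for all entries of \<open>S\<close> at
    once, in order.\<close>
  then have "S \<in> map ?cls ` lists (carrier ?P)"
    unfolding lists_image[symmetric] unfolding lists_eq_set by simp
  then obtain fs where fs: "set fs \<subseteq> carrier ?P" "S = map ?cls fs"
    unfolding lists_eq_set by blast
  have len: "length fs = n" using S(1) fs(2) by simp
  define T where "T k = map (\<lambda>f. f k) fs" for k
  define H where "H k = generate (Gs k) (set (T k))" for k
  have T: "set (T k) \<subseteq> carrier (Gs k)" for k
    using fs(1) by (auto simp: T_def)
  have H: "subgroup (H k) (Gs k)" for k
    unfolding H_def by (rule group.generate_is_subgroup[OF assms(1) T])
  have TH: "set (T k) \<subseteq> H k" for k
    unfolding H_def by (auto intro: generate.incl)
  have marked: "marked_group n ((Gs k)\<lparr>carrier := H k\<rparr>) (T k)" for k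
    using subgroup.subgroup_is_group[OF H assms(1)] TH group.generate_consistent[OF assms(1) TH H]
    by (simp add: marked_group_def T_def len H_def[symmetric]) (simp add: H_def T_def)
  have kerT: "marked_kernel ((Gs k)\<lparr>carrier := H k\<rparr>) (T k) = marked_kernel (Gs k) (T k)" for k
    by (rule marked_kernel_subgroup[OF assms(1) H TH])
  have kerS: "marked_kernel (?U\<lparr>carrier := G\<rparr>) S = marked_kernel ?U S"
    by (rule marked_kernel_subgroup[OF group_ultraproduct[OF assms(2,1)] assms(4) S(2)])
  let ?Q = "\<lambda>w k. w \<in> marked_kernel (Gs k) (T k) \<longleftrightarrow> w \<in> marked_kernel ?U S"
  have lim: "\<omega> {k. ?Q w k} = 1" if "w \<in> reduced_words n" for w
  proof -
    have iff: "w \<in> marked_kernel ?U S \<longleftrightarrow> \<omega> {k. w \<in> marked_kernel (Gs k) (T k)} = 1"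
      using mem_marked_kernel_ultraproduct[OF assms(2,1) fs(1), of w] that
      by (simp add: fs(2) len T_def)
    \<comment> \<open>As \<omega> takes only two values, a word outside the limit kernel lies
      outside almost all coordinate kernels.\<close>
    show ?thesis
    proof (cases "w \<in> marked_kernel ?U S")
      case False
      then have "\<omega> {k. w \<in> marked_kernel (Gs k) (T k)} = 0"
        using iff ultrafilter_measure_values[OF assms(2)] by blast
      with False show ?thesis
        using ultrafilter_measure_Compl[OF assms(2), of "{k. w \<in> marked_kernel (Gs k) (T k)}"]
        by (simp add: Collect_neg_eq[symmetric])
    qed (use iff in simp)
  qed
  \<comment> \<open>The diagonal argument applies because words are lists over a countable
    alphabet.\<close>
  obtain i :: "nat \<Rightarrow> nat" where "strict_mono i"
    and i: "\<And>w. w \<in> reduced_words n \<Longrightarrow> \<forall>\<^sub>F k in sequentially. ?Q w (i k)"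
    using diagonal_subsequence[where P = ?Q and W = "reduced_words n", OF assms(2,3) _ lim] by auto
  moreover have "marked_converges n (\<lambda>k. (Gs (i k))\<lparr>carrier := H (i k)\<rparr>) (\<lambda>k. T (i k))
      (?U\<lparr>carrier := G\<rparr>) S"
    using i by (subst marked_converges_iff[OF marked assms(5)]) (simp add: kerT kerS)
  ultimately show ?thesis
    using H marked by (intro exI[of _ i] exI[of _ H] exI[of _ T] conjI allI)
qed

theorem proposition6p4:
  shows
    "(\<forall>n (Gs :: nat \<Rightarrow> ('a, 'm) monoid_scheme) Ss (G :: ('b, 'k) monoid_scheme) S.
        (\<forall>k. marked_group n (Gs k) (Ss k)) \<and> marked_group n G S \<and>
        marked_accumulates n Gs Ss G S \<longrightarrow>
        (\<exists>\<omega>. ultrafilter_measure \<omega> \<and> nonprincipal \<omega> \<and>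
             (\<exists>h. h \<in> mon G (ultraproduct \<omega> Gs))))
   \<and> (\<forall>n (Gs :: nat \<Rightarrow> ('a, 'm) monoid_scheme) Ss (G :: ('b, 'k) monoid_scheme) S.
        (\<forall>k. marked_group n (Gs k) (Ss k)) \<and> marked_group n G S \<and>
        marked_converges n Gs Ss G S \<longrightarrow>
        (\<forall>\<omega>. ultrafilter_measure \<omega> \<and> nonprincipal \<omega> \<longrightarrow>
             (\<exists>h. h \<in> mon G (ultraproduct \<omega> Gs))))
   \<and> (\<forall>n (Gs :: nat \<Rightarrow> ('a, 'm) monoid_scheme) \<omega> G S.
        (\<forall>k. group (Gs k)) \<and> ultrafilter_measure \<omega> \<and> nonprincipal \<omega> \<and>
        subgroup G (ultraproduct \<omega> Gs) \<and>
        marked_group n ((ultraproduct \<omega> Gs)\<lparr>carrier := G\<rparr>) S \<longrightarrow>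
        (\<exists>(i :: nat \<Rightarrow> nat) H T. strict_mono i \<and>
           (\<forall>k. subgroup (H (i k)) (Gs (i k)) \<and>
                marked_group n ((Gs (i k))\<lparr>carrier := H (i k)\<rparr>) (T (i k))) \<and>
           marked_converges n (\<lambda>k. (Gs (i k))\<lparr>carrier := H (i k)\<rparr>) (\<lambda>k. T (i k))
             ((ultraproduct \<omega> Gs)\<lparr>carrier := G\<rparr>) S))"
proof (intro conjI allI impI; elim conjE)
  fix n Ss S and Gs :: "nat \<Rightarrow> ('a, 'm) monoid_scheme" and G :: "('b, 'k) monoid_scheme"
  assume "\<forall>k. marked_group n (Gs k) (Ss k)" "marked_group n G S" "marked_accumulates n Gs Ss G S"
  from ultraproduct_embedding_of_accumulates[OF spec[OF this(1)] this(2,3)]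
  show "\<exists>\<omega>. ultrafilter_measure \<omega> \<and> nonprincipal \<omega> \<and> (\<exists>h. h \<in> mon G (ultraproduct \<omega> Gs))" .
next
  fix n Ss S \<omega> and Gs :: "nat \<Rightarrow> ('a, 'm) monoid_scheme" and G :: "('b, 'k) monoid_scheme"
  assume "\<forall>k. marked_group n (Gs k) (Ss k)" "marked_group n G S" "marked_converges n Gs Ss G S"
    "ultrafilter_measure \<omega>" "nonprincipal \<omega>"
  from ultraproduct_embedding_of_converges[OF spec[OF this(1)] this(2-5)]
  show "\<exists>h. h \<in> mon G (ultraproduct \<omega> Gs)" .
next
  fix n \<omega> S and Gs :: "nat \<Rightarrow> ('a, 'm) monoid_scheme" and G :: "(nat \<Rightarrow> 'a) set set"
  let ?U = "(ultraproduct \<omega> Gs)\<lparr>carrier := G\<rparr>"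
  assume "\<forall>k. group (Gs k)" "ultrafilter_measure \<omega>" "nonprincipal \<omega>"
    "subgroup G (ultraproduct \<omega> Gs)" "marked_group n ?U S"
  from subgroups_converge_to_ultraproduct_subgroup[OF spec[OF this(1)] this(2-5)]
  obtain i :: "nat \<Rightarrow> nat" and H T where "strict_mono i"
    "\<forall>k. subgroup (H k) (Gs k) \<and> marked_group n ((Gs k)\<lparr>carrier := H k\<rparr>) (T k)"
    "marked_converges n (\<lambda>k. (Gs (i k))\<lparr>carrier := H (i k)\<rparr>) (\<lambda>k. T (i k)) ?U S"
    by (elim exE conjE)
  then show "\<exists>(i :: nat \<Rightarrow> nat) H T. strict_mono i \<and>
      (\<forall>k. subgroup (H (i k)) (Gs (i k)) \<and>
        marked_group n ((Gs (i k))\<lparr>carrier := H (i k)\<rparr>) (T (i k))) \<and>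
      marked_converges n (\<lambda>k. (Gs (i k))\<lparr>carrier := H (i k)\<rparr>) (\<lambda>k. T (i k)) ?U S"
    by (intro exI[of _ i] exI[of _ H] exI[of _ T] conjI) simp_all
qed

end
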